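(* Let $F:\mathcal{M}\to\mathbb{R}^n$ and $\tilde F:\mathcal{M}\to\mathbb{R}^{\tilde n}$ be embeddings whose associated datasets are conformally equivalent, i.e. there is a positive function $r:\mathcal{M}\to\mathbb{R}_+$ such that the induced metrics $g$ of $F$ and $\tilde g$ of $\tilde F$ satisfy $\tilde g|_a=r(a)\,g|_a$ for all $a\in\mathcal{M}$. Then, for every $\zeta\in[0,1)$, the metrics associated with cone kernels for $F$ and for $\tilde F$ coincide: $$\frac{1}{\|v\|_{\tilde g}^2}\left(\tilde g-\zeta\,\frac{\tilde v^*\otimes\tilde v^*}{\|v\|_{\tilde g}^2}\right)=\frac{1}{\|v\|_g^2}\left(g-\zeta\,\frac{v^*\otimes v^*}{\|v\|_g^2}\right),$$ where $v^*=g(v,\cdot)$ and $\tilde v^*=\tilde g(v,\cdot)$.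
   Context: $\mathcal{M}$ is a smooth compact $m$-dimensional manifold without boundary, carrying a nowhere-vanishing $C^1$ vector field $v$ (the dynamical vector field). Embeddings are $C^2$; the ambient spaces $\mathbb{R}^n$ and $\mathbb{R}^{\tilde n}$ carry inner products, and the metric induced by an embedding $F$ is $g(u,u')=(DF\,u,DF\,u')$ for $u,u'\in T_a\mathcal{M}$ (similarly $\tilde g$ for $\tilde F$). $\|v\|_g=\sqrt{g(v,v)}$ and $\|v\|_{\tilde g}=\sqrt{\tilde g(v,v)}$. For an embedding with induced metric $g$, the metric associated with cone kernels with parameter $\zeta\in[0,1)$ is $h=\|v\|_g^{-2}\left(g-\zeta\,\|v\|_g^{-2}\,v^*\otimes v^*\right)$. *)

theory Defs
  imports "HOL-Analysis.Analysis"
begin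

text \<open>Differentiability class \<open>C\<^sup>k\<close>; intended for open \<open>S\<close>.\<close>

primrec Ck_on :: "nat \<Rightarrow> ('e::real_normed_vector \<Rightarrow> 'f::real_normed_vector) \<Rightarrow> 'e set \<Rightarrow> bool" where
  "Ck_on 0 f S \<longleftrightarrow> continuous_on S f"
| "Ck_on (Suc k) f S \<longleftrightarrow>
     (\<exists>f'. (\<forall>x\<in>S. (f has_derivative f' x) (at x)) \<and> (\<forall>e. Ck_on k (\<lambda>x. f' x e) S))"

text \<open>A chart \<open>(U, \<phi>)\<close>; only the values of \<open>\<phi>\<close> on \<open>U\<close> are meaningful.\<close>

type_synonym ('a, 'm) chart = "'a set \<times> ('a \<Rightarrow> real ^ 'm)"

abbreviation chart_dom :: "('a, 'm::finite) chart \<Rightarrow> 'a set" where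
  "chart_dom c \<equiv> fst c"

abbreviation chart_map :: "('a, 'm::finite) chart \<Rightarrow> 'a \<Rightarrow> real ^ 'm" where
  "chart_map c \<equiv> snd c"

abbreviation chart_inv :: "('a, 'm::finite) chart \<Rightarrow> real ^ 'm \<Rightarrow> 'a" where
  "chart_inv c \<equiv> inv_into (chart_dom c) (chart_map c)"

definition is_chart :: "'a topology \<Rightarrow> ('a, 'm::finite) chart \<Rightarrow> bool" where
  "is_chart M c \<longleftrightarrow>
     openin M (chart_dom c) \<and> open (chart_map c ` chart_dom c) \<and>
     homeomorphic_map (subtopology M (chart_dom c))
       (top_of_set (chart_map c ` chart_dom c)) (chart_map c)"

definition smooth_atlas :: "'a topology \<Rightarrow> ('a, 'm::finite) chart set \<Rightarrow> bool" where
  "smooth_atlas M A \<longleftrightarrow>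
     (\<forall>c\<in>A. is_chart M c) \<and> (\<Union>c\<in>A. chart_dom c) = topspace M \<and>
     (\<forall>c\<in>A. \<forall>d\<in>A. \<forall>k.
        Ck_on k (chart_map d \<circ> chart_inv c) (chart_map c ` (chart_dom c \<inter> chart_dom d)))"

text \<open>The atlas need not be maximal. Its charts take values in open subsets of \<open>\<real>\<^sup>m\<close>, so there
  is no boundary.\<close>

definition smooth_manifold :: "'a topology \<Rightarrow> ('a, 'm::finite) chart set \<Rightarrow> bool" where
  "smooth_manifold M A \<longleftrightarrow>
     Hausdorff_space M \<and> second_countable M \<and> smooth_atlas M A"

text \<open>A tangent vector at \<open>a\<close> is the family of its coordinate vectors in the charts around \<open>a\<close>,
  transforming by the derivatives of the coordinate changes. The components at the other
  charts are set to 0, so that equality of tangent vectors is equality of families and the zero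
  vector is the zero family.\<close>

type_synonym ('a, 'm) tangent_vector = "('a, 'm) chart \<Rightarrow> real ^ 'm"

definition tangent_space ::
    "('a, 'm::finite) chart set \<Rightarrow> 'a \<Rightarrow> ('a, 'm) tangent_vector set" where
  "tangent_space A a =
     {u. (\<forall>c. c \<notin> A \<or> a \<notin> chart_dom c \<longrightarrow> u c = 0) \<and>
         (\<forall>c\<in>A. \<forall>d\<in>A. a \<in> chart_dom c \<inter> chart_dom d \<longrightarrow>
            u d = frechet_derivative (chart_map d \<circ> chart_inv c) (at (chart_map c a)) (u c))}"

definition C1_vector_field ::
    "'a topology \<Rightarrow> ('a, 'm::finite) chart set \<Rightarrow> ('a \<Rightarrow> ('a, 'm) tangent_vector) \<Rightarrow> bool" where
  "C1_vector_field M A v \<longleftrightarrow>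
     (\<forall>a\<in>topspace M. v a \<in> tangent_space A a) \<and>
     (\<forall>c\<in>A. Ck_on 1 (\<lambda>x. v (chart_inv c x) c) (chart_map c ` chart_dom c))"

definition nowhere_vanishing ::
    "'a topology \<Rightarrow> ('a \<Rightarrow> ('a, 'm::finite) tangent_vector) \<Rightarrow> bool" where
  "nowhere_vanishing M v \<longleftrightarrow> (\<forall>a\<in>topspace M. v a \<noteq> (\<lambda>c. 0))"

definition Ck_map ::
    "nat \<Rightarrow> ('a, 'm::finite) chart set \<Rightarrow> ('a \<Rightarrow> 'f::real_normed_vector) \<Rightarrow> bool" where
  "Ck_map k A F \<longleftrightarrow> (\<forall>c\<in>A. Ck_on k (F \<circ> chart_inv c) (chart_map c ` chart_dom c))"

text \<open>The differential \<open>DF\<^sub>a u\<close>, computed in some chart around \<open>a\<close>; for tangent vectors \<open>u\<close> and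
  differentiable \<open>F\<close> the result does not depend on the chart (lemma \<open>differential_eq\<close> below).\<close>

definition differential ::
    "('a, 'm::finite) chart set \<Rightarrow> ('a \<Rightarrow> 'f::real_normed_vector) \<Rightarrow> 'a
      \<Rightarrow> ('a, 'm) tangent_vector \<Rightarrow> 'f" where
  "differential A F a u =
     (let c = (SOME c. c \<in> A \<and> a \<in> chart_dom c)
      in frechet_derivative (F \<circ> chart_inv c) (at (chart_map c a)) (u c))"

definition C2_embedding ::
    "'a topology \<Rightarrow> ('a, 'm::finite) chart set \<Rightarrow> ('a \<Rightarrow> 'f::real_normed_vector) \<Rightarrow> bool" where
  "C2_embedding M A F \<longleftrightarrow>
     Ck_map 2 A F \<and> (\<forall>a\<in>topspace M. inj_on (differential A F a) (tangent_space A a)) \<and>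
     embedding_map M euclidean F"

definition is_inner_product :: "('f::real_vector \<Rightarrow> 'f \<Rightarrow> real) \<Rightarrow> bool" where
  "is_inner_product ip \<longleftrightarrow>
     bilinear ip \<and> (\<forall>x y. ip x y = ip y x) \<and> (\<forall>x. x \<noteq> 0 \<longrightarrow> ip x x > 0)"

text \<open>Fields of bilinear forms; \<open>g a\<close> is only meaningful on \<open>tangent_space A a\<close>.\<close>

type_synonym ('a, 'm) metric_field =
  "'a \<Rightarrow> ('a, 'm) tangent_vector \<Rightarrow> ('a, 'm) tangent_vector \<Rightarrow> real"

definition induced_metric ::
    "('a, 'm::finite) chart set \<Rightarrow> ('f::real_normed_vector \<Rightarrow> 'f \<Rightarrow> real) \<Rightarrow> ('a \<Rightarrow> 'f)
      \<Rightarrow> ('a, 'm) metric_field" where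
  "induced_metric A ip F a u u' = ip (differential A F a u) (differential A F a u')"

definition conformally_equivalent ::
    "'a topology \<Rightarrow> ('a, 'm::finite) chart set \<Rightarrow> ('a, 'm) metric_field
      \<Rightarrow> ('a, 'm) metric_field \<Rightarrow> bool" where
  "conformally_equivalent M A g g' \<longleftrightarrow>
     (\<exists>r :: 'a \<Rightarrow> real. (\<forall>a\<in>topspace M. r a > 0) \<and>
        (\<forall>a\<in>topspace M. \<forall>u\<in>tangent_space A a. \<forall>u'\<in>tangent_space A a.
           g' a u u' = r a * g a u u'))"

definition metric_norm ::
    "('a, 'm::finite) metric_field \<Rightarrow> 'a \<Rightarrow> ('a, 'm) tangent_vector \<Rightarrow> real" where
  "metric_norm g a u = sqrt (g a u u)"

definition flat ::
    "('a, 'm::finite) metric_field \<Rightarrow> ('a \<Rightarrow> ('a, 'm) tangent_vector)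
      \<Rightarrow> 'a \<Rightarrow> ('a, 'm) tangent_vector \<Rightarrow> real" where
  "flat g v a = g a (v a)"

definition tensor :: "('t \<Rightarrow> real) \<Rightarrow> ('t \<Rightarrow> real) \<Rightarrow> 't \<Rightarrow> 't \<Rightarrow> real" where
  "tensor \<alpha> \<beta> u u' = \<alpha> u * \<beta> u'"

definition cone_kernel_metric ::
    "('a, 'm::finite) metric_field \<Rightarrow> ('a \<Rightarrow> ('a, 'm) tangent_vector) \<Rightarrow> real
      \<Rightarrow> ('a, 'm) metric_field" where
  "cone_kernel_metric g v \<zeta> a u u' =
     1 / (metric_norm g a (v a))\<^sup>2 *
       (g a u u' - \<zeta> * (tensor (flat g v a) (flat g v a) u u' / (metric_norm g a (v a))\<^sup>2))"

lemma Ck_on_differentiable: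
  assumes "Ck_on (Suc k) f S" "x \<in> S" shows "f differentiable at x"
  using assms unfolding Ck_on.simps differentiable_def by blast

lemma is_chart_inj: "is_chart M c \<Longrightarrow> inj_on (chart_map c) (chart_dom c)"
  unfolding is_chart_def
  by (metis homeomorphic_imp_injective_map openin_subset topspace_subtopology_subset)

lemma open_chart_image:
  assumes "is_chart M c" "openin M V" "V \<subseteq> chart_dom c"
  shows "open (chart_map c ` V)"
proof -
  have "openin (subtopology M (chart_dom c)) V"
    using assms by (simp add: openin_open_subtopology is_chart_def)
  then have "openin (top_of_set (chart_map c ` chart_dom c)) (chart_map c ` V)"
    using assms(1) homeomorphic_imp_open_map open_map_def unfolding is_chart_def by blast
  then show ?thesis
    using assms(1) openin_open_trans unfolding is_chart_def by blast
qed

lemma differential_eq: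
  assumes A: "smooth_atlas M A" and F: "Ck_map (Suc k) A F"
    and c: "c \<in> A" "a \<in> chart_dom c" and u: "u \<in> tangent_space A a"
  shows "differential A F a u = frechet_derivative (F \<circ> chart_inv c) (at (chart_map c a)) (u c)"
proof -
  define d where "d = (SOME d. d \<in> A \<and> a \<in> chart_dom d)"
  have "\<exists>d. d \<in> A \<and> a \<in> chart_dom d" using c by blast
  then have d: "d \<in> A" "a \<in> chart_dom d"
    unfolding d_def by (metis (mono_tags, lifting) someI_ex)+
  let ?T = "chart_map d \<circ> chart_inv c"
  let ?W = "chart_map c ` (chart_dom c \<inter> chart_dom d)"
  have ch: "is_chart M c" "is_chart M d" using A c d by (auto simp: smooth_atlas_def)
  have inv: "chart_inv c (chart_map c b) = b" if "b \<in> chart_dom c" for b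
    using is_chart_inj[OF ch(1)] that by simp
  have inv': "chart_inv d (chart_map d b) = b" if "b \<in> chart_dom d" for b
    using is_chart_inj[OF ch(2)] that by simp
  have oW: "open ?W"
    using ch by (intro open_chart_image[OF ch(1)]) (auto simp: is_chart_def)
  have aW: "chart_map c a \<in> ?W" using c d by blast
  have "Ck_on (Suc 0) ?T ?W" using A c d by (simp add: smooth_atlas_def del: Ck_on.simps)
  then have T: "?T differentiable at (chart_map c a)"
    using aW by (rule Ck_on_differentiable)
  have "Ck_on (Suc k) (F \<circ> chart_inv d) (chart_map d ` chart_dom d)"
    using F d unfolding Ck_map_def by blast
  then have "(F \<circ> chart_inv d) differentiable at (chart_map d a)"
    using d(2) by (rule Ck_on_differentiable[OF _ imageI])
  moreover have Ta: "?T (chart_map c a) = chart_map d a" using inv c by simp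
  ultimately have "(F \<circ> chart_inv d has_derivative
      frechet_derivative (F \<circ> chart_inv d) (at (chart_map d a))) (at (?T (chart_map c a)))"
    by (metis frechet_derivative_works)
  then have D: "((F \<circ> chart_inv d) \<circ> ?T has_derivative
      frechet_derivative (F \<circ> chart_inv d) (at (chart_map d a)) \<circ>
      frechet_derivative ?T (at (chart_map c a))) (at (chart_map c a))"
    using T by (intro diff_chain_at) (auto simp: frechet_derivative_works)
  have "(F \<circ> chart_inv c has_derivative
      frechet_derivative (F \<circ> chart_inv d) (at (chart_map d a)) \<circ>
      frechet_derivative ?T (at (chart_map c a))) (at (chart_map c a))"
    using D oW aW
    by (rule has_derivative_transform_within_open) (auto simp: inv inv')
  then have "frechet_derivative (F \<circ> chart_inv c) (at (chart_map c a)) =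
      frechet_derivative (F \<circ> chart_inv d) (at (chart_map d a)) \<circ>
      frechet_derivative ?T (at (chart_map c a))"
    using frechet_derivative_at by metis
  moreover have "u d = frechet_derivative ?T (at (chart_map c a)) (u c)"
    using u c d unfolding tangent_space_def by blast
  ultimately show ?thesis
    unfolding differential_def Let_def d_def[symmetric] by simp
qed

end

theory Submission
  imports Defs
begin

text \<open>
  The cone-kernel metric is homogeneous of degree 0 in \<open>g\<close>. Under \<open>g \<mapsto> r g\<close>, the term \<open>g\<close> gains
  one factor \<open>r\<close>; the squared norm of \<open>v\<close> also gains one, and \<open>v\<^sup>* \<otimes> v\<^sup>*\<close> gains two, because each
  covector \<open>g(v, \<cdot>)\<close> depends linearly on \<open>g\<close>. So the whole bracket
  \<open>g - \<zeta> v\<^sup>* \<otimes> v\<^sup>* / \<parallel>v\<parallel>\<^sup>2\<close> gains a single factor \<open>r\<close>, which the prefactor \<open>1 / \<parallel>v\<parallel>\<^sup>2\<close> cancels. No derivative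
  of the metric enters, so the factor may differ from point to point, and it suffices to
  argue at one point (lemma \<open>cone_kernel_metric_scale\<close>).
\<close>

lemma metric_norm_power2: "(metric_norm g a w)\<^sup>2 = \<bar>g a w w\<bar>"
  by (simp add: metric_norm_def flip: real_sqrt_power)

text \<open>The scaling is asked only on a set \<open>T\<close> of vectors containing \<open>v a\<close>, since a metric field is
  meaningful only on the tangent space. The absolute value in the squared norm scales by the
  same factor as \<open>g\<close> because \<open>r > 0\<close>; and if \<open>g a (v a) (v a) = 0\<close>, division by 0 makes both sides 0.\<close>

lemma cone_kernel_metric_scale:
  assumes scale: "\<And>w w'. w \<in> T \<Longrightarrow> w' \<in> T \<Longrightarrow> g' a w w' = r * g a w w'"
    and "r > 0" and "v a \<in> T" "u \<in> T" "u' \<in> T"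
  shows "cone_kernel_metric g' v \<zeta> a u u' = cone_kernel_metric g v \<zeta> a u u'"
proof (cases "g a (v a) (v a) = 0")
  case True
  then show ?thesis
    using assms by (simp add: cone_kernel_metric_def metric_norm_power2)
next
  case False
  have norm: "(metric_norm g' a (v a))\<^sup>2 = r * (metric_norm g a (v a))\<^sup>2"
    using assms by (simp add: metric_norm_power2 abs_mult)
  have tensor: "tensor (flat g' v a) (flat g' v a) u u' =
      r\<^sup>2 * tensor (flat g v a) (flat g v a) u u'"
    using assms by (simp add: tensor_def flat_def power2_eq_square)
  have "(metric_norm g a (v a))\<^sup>2 \<noteq> 0"
    using False by (simp add: metric_norm_power2)
  then show ?thesis
    using \<open>r > 0\<close> scale[OF \<open>u \<in> T\<close> \<open>u' \<in> T\<close>]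
    unfolding cone_kernel_metric_def norm tensor
    by (simp add: field_simps power2_eq_square)
qed

theorem mainTheorem4:
  fixes M :: "'a topology"
    and A :: "('a, 'm::finite) chart set"
    and v :: "'a \<Rightarrow> ('a, 'm) tangent_vector"
    and F :: "'a \<Rightarrow> real ^ 'n::finite"
    and F' :: "'a \<Rightarrow> real ^ 'k::finite"
    and ip :: "real ^ 'n \<Rightarrow> real ^ 'n \<Rightarrow> real"
    and ip' :: "real ^ 'k \<Rightarrow> real ^ 'k \<Rightarrow> real"
    and \<zeta> :: real
  assumes "smooth_manifold M A" and "compact_space M"
    and "C1_vector_field M A v" and "nowhere_vanishing M v"
    and "is_inner_product ip" and "is_inner_product ip'"
    and "C2_embedding M A F" and "C2_embedding M A F'"
    and "conformally_equivalent M A (induced_metric A ip F) (induced_metric A ip' F')"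
    and "0 \<le> \<zeta>" and "\<zeta> < 1"
  shows "\<forall>a\<in>topspace M. \<forall>u\<in>tangent_space A a. \<forall>u'\<in>tangent_space A a.
    cone_kernel_metric (induced_metric A ip' F') v \<zeta> a u u' =
    cone_kernel_metric (induced_metric A ip F) v \<zeta> a u u'"
proof (intro ballI)
  fix a u u'
  assume a: "a \<in> topspace M" and u: "u \<in> tangent_space A a" "u' \<in> tangent_space A a"
  obtain r :: "'a \<Rightarrow> real" where r: "r a > 0"
    "\<And>w w'. w \<in> tangent_space A a \<Longrightarrow> w' \<in> tangent_space A a \<Longrightarrow>
      induced_metric A ip' F' a w w' = r a * induced_metric A ip F a w w'"
    using assms(9) a unfolding conformally_equivalent_def by blast
  have "v a \<in> tangent_space A a"
    using assms(3) a by (simp add: C1_vector_field_def)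
  then show "cone_kernel_metric (induced_metric A ip' F') v \<zeta> a u u' =
      cone_kernel_metric (induced_metric A ip F) v \<zeta> a u u'"
    using r u by (intro cone_kernel_metric_scale[where T = "tangent_space A a" and r = "r a"])
qed

end
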